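(* Let $Y$ be a random variable whose moment generating function $E[e^{tY}]$ exists for $|t|<r$, for some $r>0$, define $B_{n}^{(c,Y)}(x)$ by $$e^{x(E[e^{\frac{Y}{2}t}]-E[e^{-\frac{Y}{2}t}])}= \sum_{n=0}^{\infty}B_{n}^{(c,Y)}(x)\frac{t^{n}}{n!},$$ and write $B_{n}^{(c,Y)}=B_{n}^{(c,Y)}(1)$. Then for every $n\ge 0$, $$B_{n}^{(c,Y)}(x)= \sum_{k=0}^{n}\binom{x}{k}k!\, B_{n,k}\Big(B_{1}^{(c,Y)},B_{2}^{(c,Y)},\dots,B_{n-k+1}^{(c,Y)}\Big).$$
   Context: The partial Bell polynomials $B_{n,k}$ are defined by $\frac{1}{k!}\big(\sum_{m=1}^{\infty}x_{m}\frac{t^{m}}{m!}\big)^{k}=\sum_{n=k}^{\infty}B_{n,k}(x_{1},\dots,x_{n-k+1})\frac{t^{n}}{n!}$. $\binom{x}{k}=x(x-1)\cdots(x-k+1)/k!$. *)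

theory Defs
  imports "HOL-Probability.Probability" "HOL-Computational_Algebra.Formal_Power_Series"
begin

text \<open>
  The partial Bell polynomial $B_{n,k}$ is given by the coefficient of $t^n/n!$ in
  $\frac{1}{k!}(\sum_{m \ge 1} x_m t^m/m!)^k$, read as a formal power series identity.
  Its variables $x_1, x_2, \dots$ are passed as a function on the naturals whose value at 0 is
  ignored; by the lemma \<open>partial_bell_cong\<close> below, only $x_1, \dots, x_{n-k+1}$ matter.
\<close>

definition bell_gf :: "(nat \<Rightarrow> 'a) \<Rightarrow> 'a::field_char_0 fps" where
  "bell_gf x = Abs_fps (\<lambda>m. if m = 0 then 0 else x m / fact m)"

definition partial_bell :: "nat \<Rightarrow> nat \<Rightarrow> (nat \<Rightarrow> 'a) \<Rightarrow> 'a::field_char_0" where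
  "partial_bell n k x = fact n * fps_nth (fps_const (1 / fact k) * bell_gf x ^ k) n"

lemma partial_bell_gf:
  "fps_const (1 / fact k) * bell_gf x ^ k =
     Abs_fps (\<lambda>n. if n < k then 0 else partial_bell n k x / fact n)"
  by (rule fps_ext) (auto simp: partial_bell_def bell_gf_def startsby_zero_power_prefix)

lemma bell_gf_power_cong:
  assumes "\<And>m. 1 \<le> m \<Longrightarrow> m + k \<le> n + 1 \<Longrightarrow> x m = y m" and "0 < k"
  shows "fps_nth (bell_gf x ^ k) n = fps_nth (bell_gf y ^ k) n"
  using assms
proof (induction k arbitrary: n)
  case 0
  then show ?case by simp
next
  case (Suc k)
  show ?case
  proof (cases "k = 0")
    case True
    then show ?thesis using Suc.prems(1)[of n] by (simp add: bell_gf_def)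
  next
    case False
    have "fps_nth (bell_gf x) i * fps_nth (bell_gf x ^ k) (n - i) =
          fps_nth (bell_gf y) i * fps_nth (bell_gf y ^ k) (n - i)" if "i \<le> n" for i
    proof (cases "i = 0 \<or> n - i < k")
      case True
      then show ?thesis by (auto simp: bell_gf_def startsby_zero_power_prefix)
    next
      case i: False
      then have "1 \<le> i" "i + Suc k \<le> n + 1" using that by arith+
      then have "x i = y i" by (rule Suc.prems(1))
      moreover have "fps_nth (bell_gf x ^ k) (n - i) = fps_nth (bell_gf y ^ k) (n - i)"
        using i that False by (intro Suc.IH Suc.prems(1)) auto
      ultimately show ?thesis by (simp add: bell_gf_def)
    qed
    then show ?thesis by (simp add: fps_mult_nth)
  qed
qed

lemma partial_bell_cong:
  assumes "\<And>m. 1 \<le> m \<Longrightarrow> m \<le> n - k + 1 \<Longrightarrow> x m = y m" and "k \<le> n"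
  shows "partial_bell n k x = partial_bell n k y"
proof (cases "k = 0")
  case False
  then have "fps_nth (bell_gf x ^ k) n = fps_nth (bell_gf y ^ k) n"
    using assms by (intro bell_gf_power_cong) auto
  then show ?thesis by (simp add: partial_bell_def)
qed (simp add: partial_bell_def)

text \<open>
  The numbers $B_n^{(c,Y)}(x)$, $n \ge 0$, are the sequence \<open>b\<close> with
  $\sum_n b_n t^n/n! = \exp (x (E[e^{Yt/2}] - E[e^{-Yt/2}]))$ for all real \<open>t\<close> near 0.
\<close>

definition central_bell :: "'w measure \<Rightarrow> ('w \<Rightarrow> real) \<Rightarrow> nat \<Rightarrow> real \<Rightarrow> real" where
  "central_bell M Y n x =
     (THE b :: nat \<Rightarrow> real. \<forall>\<^sub>F t in nhds 0. (\<lambda>j. b j * (t ^ j / fact j)) sums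
        exp (x * (prob_space.expectation M (\<lambda>\<omega>. exp (Y \<omega> / 2 * t)) -
                  prob_space.expectation M (\<lambda>\<omega>. exp (- (Y \<omega> / 2) * t))))) n"

end

theory Submission
  imports Defs "HOL-Complex_Analysis.Laurent_Convergence"
begin

text \<open>
  Let $f$ be the power series of $E[e^{Yt/2}] - E[e^{-Yt/2}]$ at 0; it has no constant term, and
  $e^{xf}$ generates the numbers $B_n^{(c,Y)}(x)$. Formally $e^{xf} = (1 + (e^f - 1))^x$, and
  $e^f - 1$ is exactly the series whose powers define the partial Bell polynomials at
  $B_1^{(c,Y)}, B_2^{(c,Y)}, \dots$; the binomial series in $e^f - 1$ then gives the formula.
\<close>

unbundle no vec_syntax

text \<open>Formally e^{xt} = (1 + (e^t - 1))^x. The binomial series B solves (1 + X) B' = x B.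
  Substituting g = e^t - 1 turns this into the equation y' = x y for y = B oo g, whose solutions are
  the constant multiples of \<open>fps_exp x\<close>; the constant is 1 because g has no constant
  term.\<close>

lemma fps_exp_eq_binomial_compose:
  fixes x :: "'a::field_char_0"
  shows "fps_exp x = fps_binomial x oo (fps_exp 1 - 1)"
proof -
  define g where "g = fps_exp (1::'a) - 1"
  have g0: "g $ 0 = 0" by (simp add: g_def)
  have "(1 + fps_X) * fps_deriv (fps_binomial x) = fps_const x * fps_binomial x"
    by (simp add: fps_binomial_deriv)
  then have "((1 + fps_X) * fps_deriv (fps_binomial x)) oo g = (fps_const x * fps_binomial x) oo g"
    by (rule arg_cong)
  \<comment> \<open>Since g' = e^t = 1 + g, the factor (1 + X) oo g is exactly the inner derivative
    in the chain rule.\<close>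
  then have "fps_deriv (fps_binomial x oo g) = fps_const x * (fps_binomial x oo g)"
    using g0 by (simp add: fps_compose_deriv fps_compose_mult_distrib fps_compose_add_distrib
        fps_X_fps_compose_startby0 mult.commute) (simp add: g_def)
  then have "fps_binomial x oo g = fps_const ((fps_binomial x oo g) $ 0) * fps_exp x"
    by (simp only: fps_exp_unique_ODE)
  then show ?thesis by (simp add: g_def)
qed

text \<open>This is the whole identity at the level of formal series: expand e^{xf} in powers of e^f
  - 1. The factor k! cancels the 1/k! in \<open>partial_bell\<close>, and f having no constant term
  makes the compositions associate.\<close>

lemma fact_nth_exp_compose_eq_partial_bell_sum:
  fixes x :: "'a::field_char_0"
  assumes "f $ 0 = 0"
  shows "fact n * (fps_exp x oo f) $ n =
    (\<Sum>k=0..n. (x gchoose k) * fact k * partial_bell n k (\<lambda>m. fact m * (fps_exp 1 oo f) $ m))"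
proof -
  define g where "g = bell_gf (\<lambda>m. fact m * (fps_exp 1 oo f) $ m)"
  \<comment> \<open>\<open>bell_gf\<close> replaces the entry at index 0 by 0, where
    \<open>fps_exp 1 oo f\<close> has coefficient 1; hence the subtracted 1.\<close>
  have g: "g = (fps_exp 1 - 1) oo f"
    by (rule fps_ext) (simp add: g_def bell_gf_def fps_compose_sub_distrib)
  have "fps_exp x oo f = fps_binomial x oo g"
    unfolding fps_exp_eq_binomial_compose[of x] g
    using assms by (intro fps_compose_assoc[symmetric]) auto
  then have "fact n * (fps_exp x oo f) $ n = fact n * (\<Sum>k=0..n. (x gchoose k) * (g ^ k) $ n)"
    by (simp add: fps_compose_nth)
  also have "\<dots> = (\<Sum>k=0..n. (x gchoose k) * fact k * partial_bell n k (\<lambda>m. fact m * (fps_exp 1 oo f) $ m))"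
    by (simp add: partial_bell_def g_def sum_distrib_left mult_ac)
  finally show ?thesis .
qed

text \<open>This and the next two lemmas say that embedding real coefficients into the complex
  numbers respects evaluation, radius of convergence and composition, which is what a transfer from
  complex to real series needs.\<close>

lemma eval_fps_of_real:
  fixes F :: "real fps"
  assumes "ereal \<bar>u\<bar> < fps_conv_radius F"
  shows "eval_fps (Abs_fps (\<lambda>n. complex_of_real (F $ n))) (of_real u) = of_real (eval_fps F u)"
  using suminf_of_real[OF summable_fps[of u F], where ?'a = complex] assms
  by (simp add: eval_fps_def)

lemma fps_conv_radius_of_real:
  "fps_conv_radius (Abs_fps (\<lambda>n. complex_of_real (F $ n))) = fps_conv_radius F"
  by (simp add: fps_conv_radius_def conv_radius_def)

lemma fps_compose_of_real:
  "Abs_fps (\<lambda>n. complex_of_real (F $ n)) oo Abs_fps (\<lambda>n. complex_of_real (G $ n)) =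
   Abs_fps (\<lambda>n. complex_of_real ((F oo G) $ n))"
proof -
  have "Abs_fps (\<lambda>n. complex_of_real (G $ n)) ^ k = Abs_fps (\<lambda>n. complex_of_real ((G ^ k) $ n))" for k
    by (induction k) (auto simp: fps_eq_iff fps_mult_nth)
  then show ?thesis
    by (simp add: fps_eq_iff fps_compose_nth)
qed

text \<open>By continuity at 0, where f vanishes. With c a radius of convergence, possibly infinite,
  it keeps the values of f in the region where another series converges.\<close>

lemma has_fps_expansion_imp_eventually_small:
  fixes f :: "'a::{banach,real_normed_field} \<Rightarrow> 'a"
  assumes "f has_fps_expansion F" "fps_nth F 0 = 0" "0 < c"
  shows "\<forall>\<^sub>F t in nhds 0. ereal (norm (f t)) < c"
proof -
  obtain e where e: "e > 0" "ereal e \<le> c"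
    using assms(3) by (metis ereal_dense2 less_imp_le zero_ereal_def less_ereal.simps(1))
  have "f 0 = 0"
    using assms(1,2) by (auto simp: has_fps_expansion_def eval_fps_at_0 dest: eventually_nhds_x_imp_x)
  moreover have "isCont f 0"
    using assms(1) by (rule has_fps_expansion_imp_continuous)
  ultimately have "(f \<longlongrightarrow> 0) (nhds 0)"
    by (metis isCont_def tendsto_at_iff_tendsto_nhds)
  then have "\<forall>\<^sub>F t in nhds 0. norm (f t) < e"
    using e(1) by (auto dest: tendstoD simp: dist_norm)
  then show ?thesis
    by eventually_elim (use e(2) in \<open>meson ereal_less_le less_ereal.simps(1) order_less_le_trans\<close>)
qed

text \<open>Holomorphy gives this over the complex numbers; the real case is transferred from there.\<close>

lemma has_fps_expansion_compose_real:
  fixes f g :: "real \<Rightarrow> real"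
  assumes f: "f has_fps_expansion F" and g: "g has_fps_expansion G" and G0: "fps_nth G 0 = 0"
  shows "(\<lambda>t. f (g t)) has_fps_expansion (F oo G)"
proof -
  define C where "C H = Abs_fps (\<lambda>n. complex_of_real (H $ n))" for H
  have rad: "fps_conv_radius F > 0" "fps_conv_radius G > 0"
    using f g by (auto simp: has_fps_expansion_def)
  have "(eval_fps (C F) \<circ> eval_fps (C G)) has_fps_expansion (C F oo C G)"
    using rad G0 by (intro has_fps_expansion_compose eval_fps_has_fps_expansion)
      (simp_all add: C_def fps_conv_radius_of_real)
  then have comp: "(eval_fps (C F) \<circ> eval_fps (C G)) has_fps_expansion C (F oo G)"
    by (simp add: C_def fps_compose_of_real)
  then have radFG: "fps_conv_radius (F oo G) > 0"
    by (simp add: has_fps_expansion_def C_def fps_conv_radius_of_real)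
  \<comment> \<open>Restrict the complex identity, valid in a neighbourhood of 0, to the real
    axis.\<close>
  have "((\<lambda>t. complex_of_real t) \<longlongrightarrow> 0) (nhds 0)"
    using tendsto_of_real[OF filterlim_ident[of "nhds (0::real)"], where ?'a = complex] by simp
  with comp have ev: "\<forall>\<^sub>F t in nhds 0. eval_fps (C (F oo G)) (complex_of_real t) =
      eval_fps (C F) (eval_fps (C G) (complex_of_real t))"
    unfolding has_fps_expansion_def by (auto dest: eventually_compose_filterlim)
  have small: "\<forall>\<^sub>F t in nhds (0::real). ereal (norm t) < c" if "0 < c" for c
    using has_fps_expansion_imp_eventually_small[of "\<lambda>t::real. t", OF has_fps_expansion_fps_X _ that] by simp
  have f_eq: "\<forall>\<^sub>F t in nhds 0. eval_fps F t = f t" and g_eq: "\<forall>\<^sub>F t in nhds 0. eval_fps G t = g t"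
    using f g by (auto simp: has_fps_expansion_def)
  have "g 0 = 0"
    using g_eq G0 by (auto simp: eval_fps_at_0 dest: eventually_nhds_x_imp_x)
  with has_fps_expansion_imp_continuous[OF g] have "(g \<longlongrightarrow> 0) (nhds 0)"
    by (metis isCont_def tendsto_at_iff_tendsto_nhds)
  with f_eq have fg_eq: "\<forall>\<^sub>F t in nhds 0. eval_fps F (g t) = f (g t)"
    by (rule eventually_compose_filterlim)
  have "\<forall>\<^sub>F t in nhds 0. eval_fps (F oo G) t = f (g t)"
    using ev small[OF rad(2)] small[OF radFG] g_eq fg_eq
      has_fps_expansion_imp_eventually_small[OF g G0 rad(1)]
  proof eventually_elim
    \<comment> \<open>Here t lies within the radii of G and F oo G, and g t within that of F, so
      \<open>eval_fps_of_real\<close> applies to all three evaluations and injectivity of the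
      embedding gives the real equation.\<close>
    case (elim t)
    then show ?case
      by (simp add: C_def eval_fps_of_real)
  qed
  with radFG show ?thesis by (simp add: has_fps_expansion_def)
qed

text \<open>Zeros of a nonzero power series are isolated, whereas the difference of two expansions
  of one function vanishes on a neighbourhood of 0.\<close>

lemma has_fps_expansion_unique:
  fixes f :: "'a::{banach,real_normed_field} \<Rightarrow> 'a"
  assumes "f has_fps_expansion F" "f has_fps_expansion G"
  shows "F = G"
proof (rule ccontr)
  define H where "H = F - G"
  have H: "(\<lambda>_. 0) has_fps_expansion H"
    using has_fps_expansion_diff[OF assms] by (simp add: H_def)
  then have rad: "fps_conv_radius H > 0" and ev: "\<forall>\<^sub>F t in nhds 0. eval_fps H t = 0"
    by (auto simp: has_fps_expansion_def)
  assume "F \<noteq> G"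
  then obtain m where m: "H $ m \<noteq> 0"
    by (auto simp: H_def fps_eq_iff)
  have H0: "eval_fps H 0 = 0"
    using ev by (rule eventually_nhds_x_imp_x)
  \<comment> \<open>The constant term of H is its value at 0, hence zero;
    \<open>powser_0_nonzero\<close> asks for a nonzero coefficient of positive index.\<close>
  with m have "m > 0"
    by (cases m) (auto simp: eval_fps_at_0)
  obtain d where d: "0 < d" "ereal d < fps_conv_radius H"
    using rad by (metis ereal_dense2 zero_ereal_def less_ereal.simps(1))
  have "(\<lambda>n. H $ n * (t - 0) ^ n) sums eval_fps H t" if "norm (t - 0) < d" for t
    using that d(2) by (auto intro!: sums_eval_fps intro: less_trans[of _ "ereal d"])
  then obtain s where s: "0 < s" "\<And>z. z \<in> cball 0 s - {0} \<Longrightarrow> eval_fps H z \<noteq> 0"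
    using powser_0_nonzero[of d 0 "fps_nth H" "eval_fps H" m] d(1) H0 m \<open>m > 0\<close> by blast
  obtain e where e: "e > 0" "\<And>t. dist t 0 < e \<Longrightarrow> eval_fps H t = 0"
    using ev by (auto simp: eventually_nhds_metric)
  \<comment> \<open>A nonzero point inside both neighbourhoods; halving e makes the distance bound
    strict.\<close>
  define z :: 'a where "z = of_real (min s (e / 2))"
  have z: "norm z = min s (e / 2)"
    using s(1) e(1) by (simp add: z_def)
  then have "z \<in> cball 0 s - {0}" "dist z 0 < e"
    using s(1) e(1) by auto
  then show False
    using s(2) e(2) by blast
qed

text \<open>This makes the definite description in \<open>central_bell\<close> usable: the expansion
  supplies existence, \<open>has_fps_expansion_unique\<close> supplies uniqueness, and the factorial
  converts ordinary to exponential coefficients.\<close>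

lemma THE_exponential_coefficients:
  fixes h :: "real \<Rightarrow> real"
  assumes "h has_fps_expansion H"
  shows "(THE b. \<forall>\<^sub>F t in nhds 0. (\<lambda>j. b j * (t ^ j / fact j)) sums h t) = (\<lambda>n. fact n * H $ n)"
proof (rule the_equality)
  have rad: "fps_conv_radius H > 0"
    using assms by (simp add: has_fps_expansion_def)
  have "\<forall>\<^sub>F t in nhds (0::real). ereal (norm t) < fps_conv_radius H"
    using has_fps_expansion_imp_eventually_small[of "\<lambda>t::real. t", OF has_fps_expansion_fps_X _ rad] by simp
  moreover have "\<forall>\<^sub>F t in nhds 0. eval_fps H t = h t"
    using assms by (simp add: has_fps_expansion_def)
  ultimately show "\<forall>\<^sub>F t in nhds 0. (\<lambda>j. fact j * H $ j * (t ^ j / fact j)) sums h t"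
    by eventually_elim (use sums_eval_fps in fastforce)
next
  fix b :: "nat \<Rightarrow> real"
  assume b: "\<forall>\<^sub>F t in nhds 0. (\<lambda>j. b j * (t ^ j / fact j)) sums h t"
  then have "h has_fps_expansion Abs_fps (\<lambda>j. b j / fact j)"
    by (intro has_fps_expansionI) simp
  with assms have "H = Abs_fps (\<lambda>j. b j / fact j)"
    by (rule has_fps_expansion_unique)
  then show "b = (\<lambda>n. fact n * H $ n)" by auto
qed

text \<open>Integrate the exponential series term by term. Its absolute partial sums are at most
  e^{|tY|} \<le> e^{tY} + e^{-tY}, which is integrable because the hypothesis covers both t and
  -t.\<close>

lemma mgf_has_fps_expansion:
  fixes Y :: "'w \<Rightarrow> real"
  assumes Y [measurable]: "Y \<in> borel_measurable M" and "r > 0"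
    and int: "\<And>t. \<bar>t\<bar> < r \<Longrightarrow> integrable M (\<lambda>\<omega>. exp (t * Y \<omega>))"
  shows "(\<lambda>t. \<integral>\<omega>. exp (t * Y \<omega>) \<partial>M) has_fps_expansion
    Abs_fps (\<lambda>k. (\<integral>\<omega>. Y \<omega> ^ k \<partial>M) / fact k)"
proof (rule has_fps_expansionI)
  have "\<forall>\<^sub>F t in nhds 0. \<bar>t\<bar> < r"
    using eventually_nhds_in_open[of "ball 0 r" "0::real"] \<open>r > 0\<close> by simp
  then show "\<forall>\<^sub>F t in nhds 0. (\<lambda>k. Abs_fps (\<lambda>k. (\<integral>\<omega>. Y \<omega> ^ k \<partial>M) / fact k) $ k * t ^ k) sums
      (\<integral>\<omega>. exp (t * Y \<omega>) \<partial>M)"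
  proof eventually_elim
    case (elim t)
    define f where "f k \<omega> = (t * Y \<omega>) ^ k / fact k" for k \<omega>
    define D where "D \<omega> = exp (t * Y \<omega>) + exp (- t * Y \<omega>)" for \<omega>
    have D: "integrable M D"
      using int[of t] int[of "-t"] elim unfolding D_def by simp
    have norm_sums: "(\<lambda>k. norm (f k \<omega>)) sums exp \<bar>t * Y \<omega>\<bar>" for \<omega>
      using exp_converges[of "\<bar>t * Y \<omega>\<bar>"] by (simp add: f_def abs_mult power_abs divide_inverse_commute)
    have exp_le: "exp \<bar>t * Y \<omega>\<bar> \<le> D \<omega>" for \<omega>
      by (auto simp: D_def abs_if)
    \<comment> \<open>This one bound gives both the integrability of each term and the summability
      of the integrals of the norms.\<close>
    have partial_le: "(\<Sum>k<m. norm (f k \<omega>)) \<le> D \<omega>" for m \<omega>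
      using sum_le_suminf[OF sums_summable[OF norm_sums], of "{..<m}" \<omega>] exp_le[of \<omega>]
        sums_unique[OF norm_sums[of \<omega>]] by simp
    have f_int: "integrable M (f k)" for k
    proof (rule Bochner_Integration.integrable_bound[OF D])
      show "AE \<omega> in M. norm (f k \<omega>) \<le> norm (D \<omega>)"
      proof (intro always_eventually allI)
        fix \<omega>
        have "norm (f k \<omega>) \<le> (\<Sum>i<Suc k. norm (f i \<omega>))"
          by (simp add: sum_nonneg)
        also have "\<dots> \<le> D \<omega>"
          by (rule partial_le)
        finally show "norm (f k \<omega>) \<le> norm (D \<omega>)" by simp
      qed
    qed (simp add: f_def [abs_def])
    have "(\<lambda>k. \<integral>\<omega>. f k \<omega> \<partial>M) sums (\<integral>\<omega>. (\<Sum>k. f k \<omega>) \<partial>M)"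
    proof (rule sums_integral[OF f_int])
      show "AE \<omega> in M. summable (\<lambda>k. norm (f k \<omega>))"
        using norm_sums by (auto simp: sums_iff)
      show "summable (\<lambda>k. \<integral>\<omega>. norm (f k \<omega>) \<partial>M)"
      proof (rule summableI_nonneg_bounded)
        fix m
        have "(\<Sum>k<m. \<integral>\<omega>. norm (f k \<omega>) \<partial>M) = (\<integral>\<omega>. (\<Sum>k<m. norm (f k \<omega>)) \<partial>M)"
          using f_int by (simp add: Bochner_Integration.integral_sum)
        also have "\<dots> \<le> (\<integral>\<omega>. D \<omega> \<partial>M)"
          using f_int D partial_le by (intro integral_mono) auto
        finally show "(\<Sum>k<m. \<integral>\<omega>. norm (f k \<omega>) \<partial>M) \<le> (\<integral>\<omega>. D \<omega> \<partial>M)" .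
      qed simp
    qed
    moreover have "(\<Sum>k. f k \<omega>) = exp (t * Y \<omega>)" for \<omega>
      using exp_converges[of "t * Y \<omega>"] by (simp add: f_def sums_iff divide_inverse_commute)
    moreover have "(\<integral>\<omega>. f k \<omega> \<partial>M) = (\<integral>\<omega>. Y \<omega> ^ k \<partial>M) / fact k * t ^ k" for k
      by (simp add: f_def power_mult_distrib)
    ultimately show ?case by simp
  qed
qed

theorem theorem2p10:
  fixes M :: "'w measure" and Y :: "'w \<Rightarrow> real" and r x :: real and n :: nat
  assumes "prob_space M"
    and "Y \<in> borel_measurable M"
    and "r > 0"
    and "\<And>t. \<bar>t\<bar> < r \<Longrightarrow> integrable M (\<lambda>\<omega>. exp (t * Y \<omega>))"
  shows "central_bell M Y n x =
    (\<Sum>k=0..n. (x gchoose k) * fact k * partial_bell n k (\<lambda>m. central_bell M Y m 1))"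
proof -
  \<comment> \<open>The sign c = 1 or c = -1 treats both expectations at once.\<close>
  define G where "G c = Abs_fps (\<lambda>k. (\<integral>\<omega>. (c * (Y \<omega> / 2)) ^ k \<partial>M) / fact k)" for c
  define f where "f = G 1 - G (- 1)"
  have mgf: "(\<lambda>t. \<integral>\<omega>. exp (t * (c * (Y \<omega> / 2))) \<partial>M) has_fps_expansion G c" if "\<bar>c\<bar> = 1" for c
    unfolding G_def
  proof (rule mgf_has_fps_expansion)
    show "(\<lambda>\<omega>. c * (Y \<omega> / 2)) \<in> borel_measurable M"
      using assms(2) by simp
    \<comment> \<open>Halving Y doubles the interval on which the moment generating function
      exists.\<close>
    show "2 * r > 0" using assms(3) by simp
    show "integrable M (\<lambda>\<omega>. exp (t * (c * (Y \<omega> / 2))))" if "\<bar>t\<bar> < 2 * r" for t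
      using assms(4)[of "t * c / 2"] that \<open>\<bar>c\<bar> = 1\<close> by (simp add: abs_mult mult_ac)
  qed
  have f_expansion: "(\<lambda>t. (\<integral>\<omega>. exp (Y \<omega> / 2 * t) \<partial>M) - (\<integral>\<omega>. exp (- (Y \<omega> / 2) * t) \<partial>M))
      has_fps_expansion f"
    using has_fps_expansion_diff[OF mgf[of 1] mgf[of "- 1"]] by (simp add: f_def mult_ac)
  \<comment> \<open>The zeroth moments of Y/2 and -Y/2 agree, so the constant terms cancel.\<close>
  have f0: "f $ 0 = 0" by (simp add: f_def G_def)
  \<comment> \<open>Needed for general y: the left side of the theorem uses y = x, the arguments of
    the Bell polynomials use y = 1.\<close>
  have central: "central_bell M Y m y = fact m * (fps_exp y oo f) $ m" for m y
    unfolding central_bell_def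
    by (subst THE_exponential_coefficients[OF has_fps_expansion_compose_real[OF
          has_fps_expansion_exp f_expansion f0]]) simp
  show ?thesis
    unfolding central by (rule fact_nth_exp_compose_eq_partial_bell_sum[OF f0])
qed

end
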